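(* Fix a probability space $(\Omega,\mathcal{F}_\Omega,P)$, with a filtration $\mathbb{F}=(\mathcal{F}_1\subset\mathcal{F}_2\subset\cdots\subset\mathcal{F}_\Omega)$ on it, and a discrete-time stochastic Moore machine $f$ with state space $X$ on an interface $A=(A^+,A^-)$. Let $c$ be the stochastic clock system for $(\Omega,\mathcal{F}_\Omega,P,\mathbb{F})$, which is a system with state space $\tilde\Omega$ on the interface $(\tilde\Omega,1)$. Then system morphisms from $c$ into $f$ are in canonical bijection with behaviors of $f$ with respect to $(\Omega,\mathcal{F}_\Omega,P,\mathbb{F})$.
   Context: $\Delta$ is the Giry monad on measurable spaces: $\Delta(X)$ is the measurable space of probability measures on $X$, and for measurable $g\colon X\to Y$, $\Delta g\colon\Delta(X)\to\Delta(Y)$ is pushforward. $1=\{\ast\}$ is the one-point space. **Systems.** An interface is a pair $(A^+,A^-)$ of measurable spaces. A discrete-time stochastic Moore machine (system) on $(A^+,A^-)$ consists of a measurable space $X$ (state space), a measurable map $f\colon X\to A^+$ and a stochastic kernel $f^\sharp\colon X\times A^-\to\Delta(X)$. A system morphism from $(X_1,A_1^+,A_1^-,f_1,f_1^\sharp)$ to $(X_2,A_2^+,A_2^-,f_2,f_2^\sharp)$ consists of measurable maps $x\colon X_1\to X_2$, $a^+\colon A_1^+\to A_2^+$, $a^\flat\colon A_1^+\times A_1^-\to A_2^-$ such that for all $p\in X_1$ and $u\in A_1^-$, $$f_2(x(p))=a^+(f_1(p)),\qquad (\Delta x)(f_1^\sharp(p,u))=f_2^\sharp\bigl(x(p),a^\flat(f_1(p),u)\bigr).$$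 **Filtrations.** A filtration on $(\Omega,\mathcal{F}_\Omega)$ is an ascending sequence $\mathcal{F}_1\subset\mathcal{F}_2\subset\cdots\subset\mathcal{F}_\Omega$ of sub-$\sigma$-algebras. A sequence of variables $y_1,y_2,\ldots\colon\Omega\to Y$ is adapted to $\mathbb{F}$ if $y_i$ is measurable with respect to $\mathcal{F}_i$ for every $i$. **Conditional probability.** For a sub-$\sigma$-algebra $\mathcal{G}$ of $\mathcal{F}_\Omega$ and a measurable $z\colon\Omega\to\mathbb{R}$, a conditional expectation $\mathbb{E}_P(z\mid\mathcal{G})$ is any $\mathcal{G}$-measurable random variable with $\int_U\mathbb{E}_P(z\mid\mathcal{G})\,dP=\int_U z\,dP$ for all $U\in\mathcal{G}$; it is $P$-almost surely unique. For a measurable $y\colon\Omega\to Y$, the conditional probability of $y$ given $\mathcal{G}$ is the $\mathcal{G}$-measurable function $P(y\mid\mathcal{G})\colon\Omega\to\Delta(Y)$, defined up to $P$-almost sure equality by $P(y\mid\mathcal{G})(\omega)(V)=\mathbb{E}_P(\chi_V\circ y\mid\mathcal{G})(\omega)$ for measurable $V\subseteq Y$, where $\chi_V$ is the indicator function of $V$. **Stochastic clock system.** Let $\tilde\Omega=\sum_{i}(\Omega,\mathcal{F}_i)$ be the coproduct of measurable spaces over the indices $i$ of the filtration, with elements $(i,\omega)$. The clock $c$ is the system on $(\tilde\Omega,1)$ with state space $\tilde\Omega$, output $c((i,\omega))=(i,\omega)$, and update $c^\sharp((i,\omega),\ast)=(i+1,P(1_\Omega\mid\mathcal{F}_i)(\omega))$,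 meaning the pushforward of $P(1_\Omega\mid\mathcal{F}_i)(\omega)$ along the map $\Omega\to\tilde\Omega$, $\omega'\mapsto(i+1,\omega')$. Here $1_\Omega$ is the identity map of $\Omega$. As conditional probability is only defined up to almost-sure equality, there are technically many clock systems; "the clock system" means the one for some fixed choice of $P(1_\Omega\mid\mathcal{F}_i)\colon\Omega\to\Delta(\Omega)$ for each $i$. **Behaviors.** Given a stochastic kernel $s\colon X\to\Delta(X)$, an $\mathbb{F}$-adapted process $x_1,x_2,\ldots\colon\Omega\to X$ is Markov with law $s$ if for all $i$, $P(x_{i+1}\mid\mathcal{F}_i)(\omega)=s(x_i(\omega))$ $P$-almost everywhere. Extending this to Moore machines, a behavior of $f$ with respect to $(\Omega,\mathcal{F}_\Omega,P,\mathbb{F})$ consists of $\mathbb{F}$-adapted processes $x_1,x_2,\ldots\colon\Omega\to X$, $a_1^+,a_2^+,\ldots\colon\Omega\to A^+$ and $a_1^-,a_2^-,\ldots\colon\Omega\to A^-$ such that $$a_i^+(\omega)=f(x_i(\omega)),\qquad P(x_{i+1}\mid\mathcal{F}_i)(\omega)=f^\sharp(x_i(\omega),a_i^-(\omega)).$$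
   Formalization: In a behavior, the equation for P(x_{i+1}|F_i) is required at every point, with the version induced by the clock's fixed choice of P(1_Ω|F_i), not just almost surely; with almost-sure equality the canonical map need not be onto. *)

theory Defs
  imports "HOL-Probability.Probability"
begin

text \<open>
  A measurable space is represented by a term of type \<^typ>\<open>'a measure\<close> of which only the carrier
  \<^const>\<open>space\<close> and the sigma-algebra \<^const>\<open>sets\<close> matter. The Giry monad is \<^const>\<open>prob_algebra\<close>,
  with functorial action \<^const>\<open>distr\<close>. Maps out of a measurable space are counted as functions on its
  carrier, hence the \<^const>\<open>extensional\<close> conditions in the sets of morphisms and behaviors below.
\<close>

record ('x, 'p, 'm) system =
  states :: "'x measure"
  outputs :: "'p measure"
  inputs :: "'m measure"
  readout :: "'x \<Rightarrow> 'p"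
  update :: "'x \<times> 'm \<Rightarrow> 'x measure"

definition moore_machine :: "('x, 'p, 'm) system \<Rightarrow> bool" where
  "moore_machine S \<longleftrightarrow>
     readout S \<in> states S \<rightarrow>\<^sub>M outputs S \<and>
     update S \<in> states S \<Otimes>\<^sub>M inputs S \<rightarrow>\<^sub>M prob_algebra (states S)"

definition system_morphisms ::
  "('x1, 'p1, 'm1) system \<Rightarrow> ('x2, 'p2, 'm2) system \<Rightarrow>
    (('x1 \<Rightarrow> 'x2) \<times> ('p1 \<Rightarrow> 'p2) \<times> ('p1 \<times> 'm1 \<Rightarrow> 'm2)) set" where
  "system_morphisms S T = {(x, ap, af).
     x \<in> states S \<rightarrow>\<^sub>M states T \<and> x \<in> extensional (space (states S)) \<and>
     ap \<in> outputs S \<rightarrow>\<^sub>M outputs T \<and> ap \<in> extensional (space (outputs S)) \<and>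
     af \<in> outputs S \<Otimes>\<^sub>M inputs S \<rightarrow>\<^sub>M inputs T \<and>
     af \<in> extensional (space (outputs S \<Otimes>\<^sub>M inputs S)) \<and>
     (\<forall>p \<in> space (states S). readout T (x p) = ap (readout S p)) \<and>
     (\<forall>p \<in> space (states S). \<forall>u \<in> space (inputs S).
        distr (update S (p, u)) (states T) x = update T (x p, af (readout S p, u)))}"

definition coproduct_space :: "('i \<Rightarrow> 'a measure) \<Rightarrow> ('i \<times> 'a) measure" where
  "coproduct_space F = sigma (SIGMA i:UNIV. space (F i))
     {U. U \<subseteq> (SIGMA i:UNIV. space (F i)) \<and> (\<forall>i. Pair i -` U \<in> sets (F i))}"

text \<open>
  \<open>is_cond_prob M G Y y \<kappa>\<close>: the kernel \<open>\<kappa>\<close> is a version of the conditional probability of \<open>y\<close> given \<open>G\<close>.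
\<close>

definition is_cond_prob ::
  "'w measure \<Rightarrow> 'w measure \<Rightarrow> 'y measure \<Rightarrow> ('w \<Rightarrow> 'y) \<Rightarrow> ('w \<Rightarrow> 'y measure) \<Rightarrow> bool" where
  "is_cond_prob M G Y y \<kappa> \<longleftrightarrow>
     \<kappa> \<in> G \<rightarrow>\<^sub>M prob_algebra Y \<and>
     (\<forall>V \<in> sets Y. AE \<omega> in M.
        measure (\<kappa> \<omega>) V = real_cond_exp M G (\<lambda>\<omega>'. indicator V (y \<omega>')) \<omega>)"

text \<open>
  Filtrations are indexed from \<open>0\<close> instead of \<open>1\<close>. In what follows \<open>K i\<close> is the chosen version of the
  conditional probability of the identity of the sample space given \<open>F i\<close>.
\<close>

definition clock ::
  "(nat \<Rightarrow> 'w measure) \<Rightarrow> (nat \<Rightarrow> 'w \<Rightarrow> 'w measure) \<Rightarrow> (nat \<times> 'w, nat \<times> 'w, unit) system" where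
  "clock F K =
     \<lparr>states = coproduct_space F,
      outputs = coproduct_space F,
      inputs = count_space UNIV,
      readout = (\<lambda>s. s),
      update = (\<lambda>((i, \<omega>), _). distr (K i \<omega>) (coproduct_space F) (\<lambda>\<omega>'. (Suc i, \<omega>')))\<rparr>"

text \<open>
  In a behavior, \<open>f\<^sup>#(x\<^sub>i, a\<^sub>i)\<close> (with \<open>a\<^sub>i\<close> the input) has to be the conditional probability of
  \<open>x\<^sub>i\<^sub>+\<^sub>1\<close> given \<open>F i\<close>. As the equations in a system morphism hold at every point, so must this one:
  it says that \<open>f\<^sup>#(x\<^sub>i, a\<^sub>i)\<close> is pointwise equal to the version determined by the choice \<open>K i\<close> made for
  the clock, namely the pushforward of \<open>K i\<close> along \<open>x\<^sub>i\<^sub>+\<^sub>1\<close>. If the equation were required almost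
  everywhere only, a behavior could be altered on a null set, and would then in general no longer
  come from a system morphism.
\<close>

definition behaviors ::
  "'w measure \<Rightarrow> (nat \<Rightarrow> 'w measure) \<Rightarrow> (nat \<Rightarrow> 'w \<Rightarrow> 'w measure) \<Rightarrow> ('x, 'p, 'm) system \<Rightarrow>
    ((nat \<Rightarrow> 'w \<Rightarrow> 'x) \<times> (nat \<Rightarrow> 'w \<Rightarrow> 'p) \<times> (nat \<Rightarrow> 'w \<Rightarrow> 'm)) set" where
  "behaviors M F K S = {(x, ap, am).
     (\<forall>i. x i \<in> F i \<rightarrow>\<^sub>M states S \<and> x i \<in> extensional (space M)) \<and>
     (\<forall>i. ap i \<in> F i \<rightarrow>\<^sub>M outputs S \<and> ap i \<in> extensional (space M)) \<and>
     (\<forall>i. am i \<in> F i \<rightarrow>\<^sub>M inputs S \<and> am i \<in> extensional (space M)) \<and>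
     (\<forall>i. \<forall>\<omega> \<in> space M. ap i \<omega> = readout S (x i \<omega>)) \<and>
     (\<forall>i. is_cond_prob M (F i) (states S) (x (Suc i)) (\<lambda>\<omega>. update S (x i \<omega>, am i \<omega>))) \<and>
     (\<forall>i. \<forall>\<omega> \<in> space M. distr (K i \<omega>) (states S) (x (Suc i)) = update S (x i \<omega>, am i \<omega>))}"

definition behavior_of_morphism ::
  "(nat \<times> 'w \<Rightarrow> 'x) \<times> (nat \<times> 'w \<Rightarrow> 'p) \<times> ((nat \<times> 'w) \<times> unit \<Rightarrow> 'm) \<Rightarrow>
    (nat \<Rightarrow> 'w \<Rightarrow> 'x) \<times> (nat \<Rightarrow> 'w \<Rightarrow> 'p) \<times> (nat \<Rightarrow> 'w \<Rightarrow> 'm)" where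
  "behavior_of_morphism = (\<lambda>(x, ap, af).
     (\<lambda>i \<omega>. x (i, \<omega>), \<lambda>i \<omega>. ap (i, \<omega>), \<lambda>i \<omega>. af ((i, \<omega>), ())))"

end

theory Submission
  imports Defs
begin

text \<open>
  A map out of the coproduct of the spaces \<open>(\<Omega>, F i)\<close> is measurable iff each of its components, the
  restriction to the \<open>i\<close>-th summand, is \<open>F i\<close>-measurable (\<open>measurable_coproduct_iff\<close>). Hence a
  measurable map out of the state space of the clock is the same thing as an adapted process, and
  because the input space of the clock is a point, the same goes for the map on inputs of a system
  morphism. This currying is the bijection; it remains to match the equations.

  The clock moves from \<open>(i, \<omega>)\<close> to \<open>(i + 1, \<omega>')\<close> with \<open>\<omega>'\<close> distributed according to \<open>K i \<omega>\<close>. So pushing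
  its transition law forward along \<open>x\<close> gives the pushforward of \<open>K i \<omega>\<close> along \<open>x\<^sub>i\<^sub>+\<^sub>1\<close>
  (\<open>distr_clock_update\<close>), and the equation of a system morphism at \<open>(i, \<omega>)\<close> becomes the pointwise
  equation of a behavior at time \<open>i\<close>. That the common value of both sides is a version of the
  conditional probability of \<open>x\<^sub>i\<^sub>+\<^sub>1\<close> given \<open>F i\<close> is then automatic, since conditional probability is
  natural in the variable (\<open>is_cond_prob_distr\<close>): pushing forward the conditional probability of the
  identity gives the conditional probability of \<open>x\<^sub>i\<^sub>+\<^sub>1\<close>.
\<close>

section \<open>Coproducts of measurable spaces\<close>

lemma space_coproduct_space: "space (coproduct_space F) = (SIGMA i:UNIV. space (F i))"
  unfolding coproduct_space_def by (rule space_measure_of) auto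

lemma measurable_Pair_coproduct_space: "Pair i \<in> F i \<rightarrow>\<^sub>M coproduct_space F"
  unfolding coproduct_space_def
proof (rule measurable_measure_of)
  fix U
  assume "U \<in> {U. U \<subseteq> (SIGMA i:UNIV. space (F i)) \<and> (\<forall>i. Pair i -` U \<in> sets (F i))}"
  then show "Pair i -` U \<inter> space (F i) \<in> sets (F i)"
    by auto
qed auto

text \<open>
  The universal property of the coproduct. The family of sets in the definition of the coproduct is
  already the final sigma-algebra for the injections, so the preimage under a componentwise measurable
  map lies in that family itself.
\<close>

lemma measurable_coproduct_iff:
  "g \<in> coproduct_space F \<rightarrow>\<^sub>M N \<longleftrightarrow> (\<forall>i. (\<lambda>w. g (i, w)) \<in> F i \<rightarrow>\<^sub>M N)"
proof
  assume "g \<in> coproduct_space F \<rightarrow>\<^sub>M N"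
  then show "\<forall>i. (\<lambda>w. g (i, w)) \<in> F i \<rightarrow>\<^sub>M N"
    by (auto intro: measurable_compose[OF measurable_Pair_coproduct_space[of _ F]])
next
  assume g: "\<forall>i. (\<lambda>w. g (i, w)) \<in> F i \<rightarrow>\<^sub>M N"
  show "g \<in> coproduct_space F \<rightarrow>\<^sub>M N"
  proof (rule measurableI)
    fix p assume "p \<in> space (coproduct_space F)"
    then show "g p \<in> space N"
      using g by (auto simp: space_coproduct_space dest: measurable_space)
  next
    fix V assume V: "V \<in> sets N"
    let ?U = "g -` V \<inter> space (coproduct_space F)"
    have "Pair i -` ?U = (\<lambda>w. g (i, w)) -` V \<inter> space (F i)" for i
      by (auto simp: space_coproduct_space)
    then have "Pair i -` ?U \<in> sets (F i)" for i
      using g V by (auto dest: measurable_sets)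
    then show "?U \<in> sets (coproduct_space F)"
      unfolding coproduct_space_def
      by (subst sets_measure_of) (auto simp: space_measure_of_conv)
  qed
qed

text \<open>
  A one-point factor does not change a measurable space; this is what turns the input map of a
  morphism out of the clock into a map on the coproduct alone.
\<close>

lemma measurable_pair_unit_iff:
  "g \<in> N \<Otimes>\<^sub>M count_space (UNIV :: unit set) \<rightarrow>\<^sub>M L \<longleftrightarrow> (\<lambda>p. g (p, ())) \<in> N \<rightarrow>\<^sub>M L"
proof
  assume "g \<in> N \<Otimes>\<^sub>M count_space (UNIV :: unit set) \<rightarrow>\<^sub>M L"
  then show "(\<lambda>p. g (p, ())) \<in> N \<rightarrow>\<^sub>M L"
    by (rule measurable_compose[rotated]) simp
next
  assume "(\<lambda>p. g (p, ())) \<in> N \<rightarrow>\<^sub>M L"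
  then have "(\<lambda>q. g (fst q, ())) \<in> N \<Otimes>\<^sub>M count_space (UNIV :: unit set) \<rightarrow>\<^sub>M L"
    by (rule measurable_compose[OF measurable_fst])
  moreover have "(\<lambda>q. g (fst q, ())) = g"
    by (auto simp: fun_eq_iff)
  ultimately show "g \<in> N \<Otimes>\<^sub>M count_space (UNIV :: unit set) \<rightarrow>\<^sub>M L"
    by simp
qed

section \<open>Conditional probability and pushforward\<close>

text \<open>
  Naturality of conditional probability: \<open>measure (distr (\<kappa> \<omega>) Z g) V\<close> is \<open>\<kappa> \<omega>\<close> evaluated at the preimage
  of \<open>V\<close>, and the indicator of that preimage, composed with \<open>y\<close>, is the indicator of \<open>V\<close> composed with
  \<open>g \<circ> y\<close>.
\<close>

lemma is_cond_prob_distr: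
  assumes M: "prob_space M" and G: "subalgebra M G" and y: "y \<in> M \<rightarrow>\<^sub>M Y"
    and \<kappa>: "is_cond_prob M G Y y \<kappa>" and g: "g \<in> Y \<rightarrow>\<^sub>M Z"
  shows "is_cond_prob M G Z (\<lambda>\<omega>. g (y \<omega>)) (\<lambda>\<omega>. distr (\<kappa> \<omega>) Z g)"
proof -
  interpret prob_space M by (rule M)
  interpret sigma_finite_subalgebra M G
    using G finite_measure_axioms
    by (simp add: finite_measure_subalgebra_def finite_measure_subalgebra_axioms_def
        finite_measure_subalgebra_is_sigma_finite)
  have meas: "\<kappa> \<in> G \<rightarrow>\<^sub>M prob_algebra Y"
    using \<kappa> by (simp add: is_cond_prob_def)
  have "AE \<omega> in M. measure (distr (\<kappa> \<omega>) Z g) V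
      = real_cond_exp M G (\<lambda>\<omega>'. indicator V (g (y \<omega>'))) \<omega>" if V: "V \<in> sets Z" for V
  proof -
    let ?W = "g -` V \<inter> space Y"
    have W: "?W \<in> sets Y"
      using g V by (rule measurable_sets)
    have "AE \<omega> in M. real_cond_exp M G (\<lambda>\<omega>'. indicator ?W (y \<omega>')) \<omega>
        = real_cond_exp M G (\<lambda>\<omega>'. indicator V (g (y \<omega>'))) \<omega>"
    proof (rule real_cond_exp_cong)
      show "AE \<omega> in M. indicator ?W (y \<omega>) = (indicator V (g (y \<omega>)) :: real)"
        using measurable_space[OF y] by (intro AE_I2) (simp add: indicator_def)
      show "(\<lambda>\<omega>. indicator ?W (y \<omega>)) \<in> borel_measurable M"
        using y borel_measurable_indicator[OF W] by (rule measurable_compose)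
      show "(\<lambda>\<omega>. indicator V (g (y \<omega>))) \<in> borel_measurable M"
        using measurable_compose[OF y g] borel_measurable_indicator[OF V]
        by (rule measurable_compose)
    qed
    moreover have "AE \<omega> in M. measure (\<kappa> \<omega>) ?W
        = real_cond_exp M G (\<lambda>\<omega>'. indicator ?W (y \<omega>')) \<omega>"
      using \<kappa> W by (simp add: is_cond_prob_def)
    moreover have "AE \<omega> in M. measure (distr (\<kappa> \<omega>) Z g) V = measure (\<kappa> \<omega>) ?W"
    proof (rule AE_I2)
      fix \<omega> assume "\<omega> \<in> space M"
      then have "\<omega> \<in> space G"
        using G by (simp add: subalgebra_def)
      then have \<kappa>_sets: "sets (\<kappa> \<omega>) = sets Y"
        using measurable_space[OF meas] by (simp add: space_prob_algebra)
      have "g \<in> \<kappa> \<omega> \<rightarrow>\<^sub>M Z"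
        using g by (simp only: measurable_cong_sets[OF \<kappa>_sets refl])
      then show "measure (distr (\<kappa> \<omega>) Z g) V = measure (\<kappa> \<omega>) ?W"
        using V by (simp only: measure_distr sets_eq_imp_space_eq[OF \<kappa>_sets])
    qed
    ultimately show ?thesis
      by eventually_elim simp
  qed
  then show ?thesis
    using measurable_compose[OF meas measurable_distr_prob_space[OF g]]
    by (simp add: is_cond_prob_def)
qed

lemma is_cond_prob_cong:
  assumes \<kappa>: "is_cond_prob M G Y y \<kappa>" and G: "subalgebra M G"
    and eq: "\<And>\<omega>. \<omega> \<in> space M \<Longrightarrow> \<kappa> \<omega> = \<kappa>' \<omega>"
  shows "is_cond_prob M G Y y \<kappa>'"
proof -
  have "\<kappa>' \<in> G \<rightarrow>\<^sub>M prob_algebra Y"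
    using \<kappa> G eq measurable_cong[of G \<kappa> \<kappa>' "prob_algebra Y"]
    by (simp add: is_cond_prob_def subalgebra_def)
  moreover have "AE \<omega> in M. measure (\<kappa>' \<omega>) V = real_cond_exp M G (\<lambda>\<omega>'. indicator V (y \<omega>')) \<omega>"
    if "V \<in> sets Y" for V
  proof -
    have "AE \<omega> in M. measure (\<kappa> \<omega>) V = real_cond_exp M G (\<lambda>\<omega>'. indicator V (y \<omega>')) \<omega>"
      using \<kappa> that by (simp add: is_cond_prob_def)
    then show ?thesis
      using AE_space[of M] by eventually_elim (simp add: eq)
  qed
  ultimately show ?thesis
    by (simp add: is_cond_prob_def)
qed

section \<open>The clock system\<close>

lemma measurable_Pair_coproduct_subalgebra:
  assumes "subalgebra M (F i)"
  shows "Pair i \<in> M \<rightarrow>\<^sub>M coproduct_space F"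
  using assms by (rule measurable_from_subalg[OF _ measurable_Pair_coproduct_space])

lemma moore_machine_clock:
  assumes sub: "\<And>i. subalgebra M (F i)" and K: "\<And>i. K i \<in> F i \<rightarrow>\<^sub>M prob_algebra M"
  shows "moore_machine (clock F K)"
proof -
  have "(\<lambda>\<omega>. distr (K i \<omega>) (coproduct_space F) (Pair (Suc i)))
      \<in> F i \<rightarrow>\<^sub>M prob_algebra (coproduct_space F)" for i
    using K measurable_distr_prob_space[OF measurable_Pair_coproduct_subalgebra[of M F "Suc i", OF sub]]
    by (rule measurable_compose)
  then show ?thesis
    by (simp add: moore_machine_def clock_def measurable_pair_unit_iff measurable_coproduct_iff
        measurable_Pair_coproduct_space)
qed

lemma distr_clock_update:
  assumes sub: "\<And>i. subalgebra M (F i)" and K: "\<And>i. K i \<in> F i \<rightarrow>\<^sub>M prob_algebra M"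
    and x: "x \<in> coproduct_space F \<rightarrow>\<^sub>M N" and \<omega>: "\<omega> \<in> space M"
  shows "distr (update (clock F K) ((i, \<omega>), u)) N x = distr (K i \<omega>) N (\<lambda>\<omega>'. x (Suc i, \<omega>'))"
proof -
  have "\<omega> \<in> space (F i)"
    using \<omega> sub[of i] by (simp add: subalgebra_def)
  then have "sets (K i \<omega>) = sets M"
    using measurable_space[OF K] by (simp add: space_prob_algebra)
  then have "Pair (Suc i) \<in> K i \<omega> \<rightarrow>\<^sub>M coproduct_space F"
    using measurable_Pair_coproduct_subalgebra[of M F "Suc i", OF sub]
    by (simp add: measurable_cong_sets[of "K i \<omega>" M])
  then show ?thesis
    using x by (simp add: clock_def distr_distr comp_def)
qed

section \<open>Morphisms out of the clock and behaviors\<close>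

text \<open>
  A behavior extends to the coproduct by a default value off the carrier, as morphisms are
  extensional.
\<close>

definition morphism_of_behavior ::
  "'w measure \<Rightarrow> (nat \<Rightarrow> 'w \<Rightarrow> 'x) \<times> (nat \<Rightarrow> 'w \<Rightarrow> 'p) \<times> (nat \<Rightarrow> 'w \<Rightarrow> 'm) \<Rightarrow>
    (nat \<times> 'w \<Rightarrow> 'x) \<times> (nat \<times> 'w \<Rightarrow> 'p) \<times> ((nat \<times> 'w) \<times> unit \<Rightarrow> 'm)" where
  "morphism_of_behavior M = (\<lambda>(x, ap, am).
     (restrict (\<lambda>(i, \<omega>). x i \<omega>) (UNIV \<times> space M),
      restrict (\<lambda>(i, \<omega>). ap i \<omega>) (UNIV \<times> space M),
      restrict (\<lambda>((i, \<omega>), _). am i \<omega>) ((UNIV \<times> space M) \<times> UNIV)))"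

text \<open>
  The defining conditions of both sides are equivalent under currying. The requirement of being a
  conditional probability follows from the pointwise equation, by naturality applied to \<open>K i\<close>.
\<close>

lemma behavior_of_morphism_in_behaviors_iff:
  assumes M: "prob_space M" and sub: "\<And>i. subalgebra M (F i)"
    and K: "\<And>i. is_cond_prob M (F i) M (\<lambda>\<omega>. \<omega>) (K i)"
    and ext: "x \<in> extensional (UNIV \<times> space M)" "ap \<in> extensional (UNIV \<times> space M)"
      "af \<in> extensional ((UNIV \<times> space M) \<times> UNIV)"
  shows "behavior_of_morphism (x, ap, af) \<in> behaviors M F K f \<longleftrightarrow>
    (x, ap, af) \<in> system_morphisms (clock F K) f"
proof -
  have sp: "space (F i) = space M" for i
    using sub[of i] by (simp add: subalgebra_def)
  have Km: "K i \<in> F i \<rightarrow>\<^sub>M prob_algebra M" for i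
    using K[of i] by (simp add: is_cond_prob_def)
  have spc: "space (coproduct_space F) = UNIV \<times> space M"
    by (simp add: space_coproduct_space sp)
  let ?x = "\<lambda>i \<omega>. x (i, \<omega>)" and ?a = "\<lambda>i \<omega>. af ((i, \<omega>), ())"
  have law: "is_cond_prob M (F i) (states f) (?x (Suc i)) (\<lambda>\<omega>. update f (?x i \<omega>, ?a i \<omega>))"
    if x: "\<forall>i. ?x i \<in> F i \<rightarrow>\<^sub>M states f"
      and eq: "\<forall>i. \<forall>\<omega> \<in> space M.
        distr (K i \<omega>) (states f) (?x (Suc i)) = update f (?x i \<omega>, ?a i \<omega>)" for i
  proof (rule is_cond_prob_cong)
    have "?x (Suc i) \<in> M \<rightarrow>\<^sub>M states f"
      using sub x by (blast intro: measurable_from_subalg)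
    then show "is_cond_prob M (F i) (states f) (?x (Suc i))
        (\<lambda>\<omega>. distr (K i \<omega>) (states f) (?x (Suc i)))"
      by (rule is_cond_prob_distr[OF M sub measurable_ident_sets[OF refl] K])
  qed (use sub eq in auto)
  have upd: "(\<forall>p \<in> space (coproduct_space F).
        distr (update (clock F K) (p, ())) (states f) x = update f (x p, af (p, ())))
      \<longleftrightarrow> (\<forall>i. \<forall>\<omega> \<in> space M.
        distr (K i \<omega>) (states f) (?x (Suc i)) = update f (?x i \<omega>, ?a i \<omega>))"
    if "x \<in> coproduct_space F \<rightarrow>\<^sub>M states f"
    using distr_clock_update[of M F K x "states f", OF sub Km that] by (auto simp: spc)
  have readouts: "(\<forall>p \<in> space (coproduct_space F). readout f (x p) = ap p)
      \<longleftrightarrow> (\<forall>i. \<forall>\<omega> \<in> space M. ap (i, \<omega>) = readout f (?x i \<omega>))"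
    by (simp add: spc eq_commute)
  have slices: "?x i \<in> extensional (space M)" "(\<lambda>\<omega>. ap (i, \<omega>)) \<in> extensional (space M)"
      "?a i \<in> extensional (space M)" for i
    using ext by (auto simp: extensional_def)
  have clock_fields: "states (clock F K) = coproduct_space F"
      "outputs (clock F K) = coproduct_space F"
      "inputs (clock F K) = count_space UNIV" "readout (clock F K) = (\<lambda>s. s)"
    by (simp_all add: clock_def)
  have "(x, ap, af) \<in> system_morphisms (clock F K) f \<longleftrightarrow>
      x \<in> coproduct_space F \<rightarrow>\<^sub>M states f \<and> ap \<in> coproduct_space F \<rightarrow>\<^sub>M outputs f \<and>
      (\<lambda>p. af (p, ())) \<in> coproduct_space F \<rightarrow>\<^sub>M inputs f \<and>
      (\<forall>p \<in> space (coproduct_space F). readout f (x p) = ap p) \<and>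
      (\<forall>p \<in> space (coproduct_space F).
        distr (update (clock F K) (p, ())) (states f) x = update f (x p, af (p, ())))"
    using ext
    by (simp add: system_morphisms_def clock_fields spc space_pair_measure
        measurable_pair_unit_iff)
  also have "\<dots> \<longleftrightarrow> (\<forall>i. ?x i \<in> F i \<rightarrow>\<^sub>M states f) \<and>
      (\<forall>i. (\<lambda>\<omega>. ap (i, \<omega>)) \<in> F i \<rightarrow>\<^sub>M outputs f) \<and> (\<forall>i. ?a i \<in> F i \<rightarrow>\<^sub>M inputs f) \<and>
      (\<forall>i. \<forall>\<omega> \<in> space M. ap (i, \<omega>) = readout f (?x i \<omega>)) \<and>
      (\<forall>i. \<forall>\<omega> \<in> space M.
        distr (K i \<omega>) (states f) (?x (Suc i)) = update f (?x i \<omega>, ?a i \<omega>))"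
    unfolding readouts measurable_coproduct_iff
    using upd[unfolded measurable_coproduct_iff] by blast
  also have "\<dots> \<longleftrightarrow> behavior_of_morphism (x, ap, af) \<in> behaviors M F K f"
    unfolding behavior_of_morphism_def behaviors_def prod.case mem_Collect_eq
    using law slices by blast
  finally show ?thesis by blast
qed

theorem theorem4p10:
  fixes M :: "'w measure"
    and F :: "nat \<Rightarrow> 'w measure"
    and K :: "nat \<Rightarrow> 'w \<Rightarrow> 'w measure"
    and f :: "('x, 'p, 'm) system"
  assumes "prob_space M"
    and "filtration (space M) F"
    and "\<And>i. subalgebra M (F i)"
    and "\<And>i. is_cond_prob M (F i) M (\<lambda>\<omega>. \<omega>) (K i)"
    and "moore_machine f"
  shows "moore_machine (clock F K) \<and>
    bij_betw behavior_of_morphism (system_morphisms (clock F K) f) (behaviors M F K f)"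
proof
  show "moore_machine (clock F K)"
    using assms(3,4) by (intro moore_machine_clock[of M]) (auto simp: is_cond_prob_def)
  have sp: "space (F i) = space M" for i
    using assms(3)[of i] by (simp add: subalgebra_def)
  note iff = behavior_of_morphism_in_behaviors_iff[OF assms(1) assms(3) assms(4), where f = f]
  have ext: "x \<in> extensional (UNIV \<times> space M) \<and> ap \<in> extensional (UNIV \<times> space M) \<and>
      af \<in> extensional ((UNIV \<times> space M) \<times> UNIV)"
    if "(x, ap, af) \<in> system_morphisms (clock F K) f" for x ap af
    using that
    by (simp add: system_morphisms_def clock_def space_coproduct_space sp space_pair_measure)
  have inv: "behavior_of_morphism (morphism_of_behavior M b) = b"
    if "b \<in> behaviors M F K f" for b
    using that
    by (auto simp: behaviors_def behavior_of_morphism_def morphism_of_behavior_def fun_eq_iff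
        extensional_def)
  show "bij_betw behavior_of_morphism (system_morphisms (clock F K) f) (behaviors M F K f)"
  proof (rule bij_betw_byWitness[where f' = "morphism_of_behavior M"])
    show "\<forall>m \<in> system_morphisms (clock F K) f.
        morphism_of_behavior M (behavior_of_morphism m) = m"
    proof
      fix m assume m: "m \<in> system_morphisms (clock F K) f"
      obtain x ap af where [simp]: "m = (x, ap, af)" by (cases m)
      show "morphism_of_behavior M (behavior_of_morphism m) = m"
        using ext[of x ap af] m
        by (auto simp: behavior_of_morphism_def morphism_of_behavior_def fun_eq_iff
            extensional_def restrict_def)
    qed
    show "\<forall>b \<in> behaviors M F K f. behavior_of_morphism (morphism_of_behavior M b) = b"
      using inv by blast
    show "behavior_of_morphism ` system_morphisms (clock F K) f \<subseteq> behaviors M F K f"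
      using ext iff by (auto simp del: split_paired_All)
    show "morphism_of_behavior M ` behaviors M F K f \<subseteq> system_morphisms (clock F K) f"
    proof
      fix m assume "m \<in> morphism_of_behavior M ` behaviors M F K f"
      then obtain b where b: "b \<in> behaviors M F K f" and m: "m = morphism_of_behavior M b"
        by blast
      obtain x ap af where xs: "m = (x, ap, af)" by (cases m)
      have "x \<in> extensional (UNIV \<times> space M)" "ap \<in> extensional (UNIV \<times> space M)"
          "af \<in> extensional ((UNIV \<times> space M) \<times> UNIV)"
        using m by (auto simp: xs morphism_of_behavior_def split: prod.splits)
      then show "m \<in> system_morphisms (clock F K) f"
        using iff[of x ap af] inv[OF b] b m xs by simp
    qed
  qed
qed

end
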